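(* Let $H$ be a commutative ring with identity, let $S=\mathrm{reg}(H)$, and let $A$ be a proper ideal of $H$ with $S\cap A=\varnothing$. Then the following statements are equivalent: (a) $A$ is an $S$-$r$-ideal of $H$. (b) There exists $s\in S$ such that $s\,(rH\cap A)\subseteq rA$ for all $r\in \mathrm{reg}(H)$. (c) There exists $s\in S$ such that $s\,(A:r)\subseteq A$ for all $r\in \mathrm{reg}(H)$. (d) There exists $s\in S$ such that $s\,\pi^{-1}(S^{-1}A)\subseteq A$, where $\pi:H\to S^{-1}H$ is the natural map.
   Context: For $w\in H$, $\mathrm{Ann}(w)=\{y\in H: yw=0\}$. An element $w$ is regular if $\mathrm{Ann}(w)=0$; $\mathrm{reg}(H)$ is the set of regular elements of $H$. For an ideal $A$ and $r\in H$, $(A:r)=\{y\in H: yr\in A\}$. A multiplicatively closed subset $S$ of $H$ is a subset containing $1$ and closed under products. For a multiplicatively closed subset $S$, an ideal $A$ of $H$ is an $S$-$r$-ideal if $A\cap S=\varnothing$ and there exists $s\in S$ such that for all $w,z\in H$, if $wz\in A$ and $\mathrm{Ann}(w)=0$, then $sz\in A$. *)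

theory Defs
  imports "HOL-Algebra.RingHom"
begin

section \<open>Annihilators, regular elements, colon ideals\<close>

definition Ann :: "('a, 'm) ring_scheme \<Rightarrow> 'a \<Rightarrow> 'a set" where
  "Ann H w = {y \<in> carrier H. y \<otimes>\<^bsub>H\<^esub> w = \<zero>\<^bsub>H\<^esub>}"

definition reg :: "('a, 'm) ring_scheme \<Rightarrow> 'a set" where
  "reg H = {w \<in> carrier H. Ann H w = {\<zero>\<^bsub>H\<^esub>}}"

definition colon :: "('a, 'm) ring_scheme \<Rightarrow> 'a set \<Rightarrow> 'a \<Rightarrow> 'a set" where
  "colon H A r = {y \<in> carrier H. y \<otimes>\<^bsub>H\<^esub> r \<in> A}"


section \<open>\<open>S\<close>-\<open>r\<close>-ideals\<close>

text \<open>A multiplicatively closed subset of a ring is a \<^const>\<open>submonoid\<close> of its multiplicative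
  monoid; it may contain zero and zero divisors.\<close>

definition S_r_ideal :: "('a, 'm) ring_scheme \<Rightarrow> 'a set \<Rightarrow> 'a set \<Rightarrow> bool" where
  "S_r_ideal H S A \<longleftrightarrow>
     submonoid S H \<and> ideal A H \<and> A \<inter> S = {} \<and>
     (\<exists>s\<in>S. \<forall>w\<in>carrier H. \<forall>z\<in>carrier H.
        w \<otimes>\<^bsub>H\<^esub> z \<in> A \<longrightarrow> Ann H w = {\<zero>\<^bsub>H\<^esub>} \<longrightarrow> s \<otimes>\<^bsub>H\<^esub> z \<in> A)"


section \<open>Localization at a multiplicatively closed subset\<close>

definition loc_rel :: "('a, 'm) ring_scheme \<Rightarrow> 'a set \<Rightarrow> (('a \<times> 'a) \<times> ('a \<times> 'a)) set" where
  "loc_rel H S = {((a, s), (b, t)). a \<in> carrier H \<and> s \<in> S \<and> b \<in> carrier H \<and> t \<in> S \<and>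
     (\<exists>u\<in>S. u \<otimes>\<^bsub>H\<^esub> (a \<otimes>\<^bsub>H\<^esub> t \<ominus>\<^bsub>H\<^esub> b \<otimes>\<^bsub>H\<^esub> s) = \<zero>\<^bsub>H\<^esub>)}"

definition loc_frac :: "('a, 'm) ring_scheme \<Rightarrow> 'a set \<Rightarrow> 'a \<Rightarrow> 'a \<Rightarrow> ('a \<times> 'a) set" where
  "loc_frac H S a s = loc_rel H S `` {(a, s)}"

text \<open>Sums and products are formed on all representatives; the union collapses to a single class
  because the operations respect \<^const>\<open>loc_rel\<close> (lemmas \<open>mult_frac\<close> and \<open>add_frac\<close> below).\<close>

definition localization ::
  "('a, 'm) ring_scheme \<Rightarrow> 'a set \<Rightarrow> ('a \<times> 'a) set ring" where
  "localization H S =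
    \<lparr>carrier = (carrier H \<times> S) // loc_rel H S,
     monoid.mult = (\<lambda>U V. \<Union>(a, s)\<in>U. \<Union>(b, t)\<in>V. loc_frac H S (a \<otimes>\<^bsub>H\<^esub> b) (s \<otimes>\<^bsub>H\<^esub> t)),
     one = loc_frac H S \<one>\<^bsub>H\<^esub> \<one>\<^bsub>H\<^esub>,
     zero = loc_frac H S \<zero>\<^bsub>H\<^esub> \<one>\<^bsub>H\<^esub>,
     add = (\<lambda>U V. \<Union>(a, s)\<in>U. \<Union>(b, t)\<in>V.
              loc_frac H S (a \<otimes>\<^bsub>H\<^esub> t \<oplus>\<^bsub>H\<^esub> b \<otimes>\<^bsub>H\<^esub> s) (s \<otimes>\<^bsub>H\<^esub> t))\<rparr>"

definition loc_map :: "('a, 'm) ring_scheme \<Rightarrow> 'a set \<Rightarrow> 'a \<Rightarrow> ('a \<times> 'a) set" where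
  "loc_map H S x = loc_frac H S x \<one>\<^bsub>H\<^esub>"

definition loc_ideal :: "('a, 'm) ring_scheme \<Rightarrow> 'a set \<Rightarrow> 'a set \<Rightarrow> ('a \<times> 'a) set set" where
  "loc_ideal H S A = {loc_frac H S a s | a s. a \<in> A \<and> s \<in> S}"


section \<open>The localization is a commutative ring\<close>

locale ring_with_mult_subset = cring R + submonoid S R for S and R (structure)
begin

lemma S_carrier: "s \<in> S \<Longrightarrow> s \<in> carrier R"
  using subset by blast

lemma loc_relI:
  assumes "u \<in> S" "a \<in> carrier R" "s \<in> S" "b \<in> carrier R" "t \<in> S"
    and "u \<otimes> (a \<otimes> t \<ominus> b \<otimes> s) = \<zero>"
  shows "((a, s), (b, t)) \<in> loc_rel R S"
  using assms by (auto simp: loc_rel_def)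

lemma equiv_loc_rel: "equiv (carrier R \<times> S) (loc_rel R S)"
proof (rule equivI)
  show "loc_rel R S \<subseteq> (carrier R \<times> S) \<times> (carrier R \<times> S)"
    by (auto simp: loc_rel_def)
  show "refl_on (carrier R \<times> S) (loc_rel R S)"
  proof (rule refl_onI)
    fix p assume "p \<in> carrier R \<times> S"
    then obtain a s where p: "p = (a, s)" "a \<in> carrier R" "s \<in> S" by auto
    then have "\<one> \<otimes> (a \<otimes> s \<ominus> a \<otimes> s) = \<zero>"
      using S_carrier[of s] by algebra
    then show "(p, p) \<in> loc_rel R S"
      using p by (auto intro: loc_relI[OF submonoid.one_closed[OF is_submonoid]])
  qed
  show "sym (loc_rel R S)"
  proof (rule symI)
    fix p q assume "(p, q) \<in> loc_rel R S"
    then obtain a s b t u where pq: "p = (a, s)" "q = (b, t)"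
      and c: "a \<in> carrier R" "s \<in> S" "b \<in> carrier R" "t \<in> S" "u \<in> S"
      and e: "u \<otimes> (a \<otimes> t \<ominus> b \<otimes> s) = \<zero>"
      by (auto simp: loc_rel_def)
    have "u \<otimes> (b \<otimes> s \<ominus> a \<otimes> t) = \<ominus> (u \<otimes> (a \<otimes> t \<ominus> b \<otimes> s))"
      using c S_carrier[of s] S_carrier[of t] S_carrier[of u] by algebra
    then show "(q, p) \<in> loc_rel R S"
      using c e pq by (auto intro: loc_relI)
  qed
  show "trans (loc_rel R S)"
  proof (rule transI)
    fix p q r assume "(p, q) \<in> loc_rel R S" "(q, r) \<in> loc_rel R S"
    then obtain a s b t c w u v where pq: "p = (a, s)" "q = (b, t)" "r = (c, w)"
      and c: "a \<in> carrier R" "s \<in> S" "b \<in> carrier R" "t \<in> S" "c \<in> carrier R" "w \<in> S"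
        "u \<in> S" "v \<in> S"
      and e: "u \<otimes> (a \<otimes> t \<ominus> b \<otimes> s) = \<zero>" "v \<otimes> (b \<otimes> w \<ominus> c \<otimes> t) = \<zero>"
      by (auto simp: loc_rel_def)
    have "u \<otimes> v \<otimes> t \<otimes> (a \<otimes> w \<ominus> c \<otimes> s) =
        v \<otimes> w \<otimes> (u \<otimes> (a \<otimes> t \<ominus> b \<otimes> s)) \<oplus> u \<otimes> s \<otimes> (v \<otimes> (b \<otimes> w \<ominus> c \<otimes> t))"
      using c S_carrier[of s] S_carrier[of t] S_carrier[of u] S_carrier[of v] S_carrier[of w]
      by algebra
    then have "u \<otimes> v \<otimes> t \<otimes> (a \<otimes> w \<ominus> c \<otimes> s) = \<zero>"
      using c e S_carrier by simp
    then show "(p, r) \<in> loc_rel R S"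
      using c pq by (auto intro!: loc_relI[of "u \<otimes> v \<otimes> t"])
  qed
qed

lemma frac_in_carrier:
  "a \<in> carrier R \<Longrightarrow> s \<in> S \<Longrightarrow> loc_frac R S a s \<in> carrier (localization R S)"
  by (auto simp: localization_def loc_frac_def intro: quotientI)

lemma carrier_cases:
  assumes "U \<in> carrier (localization R S)"
  obtains a s where "a \<in> carrier R" "s \<in> S" "U = loc_frac R S a s"
  using assms by (auto simp: localization_def loc_frac_def elim!: quotientE)

lemma frac_eq_iff:
  assumes "a \<in> carrier R" "s \<in> S" "b \<in> carrier R" "t \<in> S"
  shows "loc_frac R S a s = loc_frac R S b t \<longleftrightarrow> (\<exists>u\<in>S. u \<otimes> (a \<otimes> t \<ominus> b \<otimes> s) = \<zero>)"
  using eq_equiv_class_iff[OF equiv_loc_rel, of "(a, s)" "(b, t)"] assms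
  by (auto simp: loc_frac_def loc_rel_def)

lemma frac_eqI:
  assumes "a \<in> carrier R" "s \<in> S" "b \<in> carrier R" "t \<in> S" "a \<otimes> t = b \<otimes> s"
  shows "loc_frac R S a s = loc_frac R S b t"
proof -
  have "\<one> \<otimes> (a \<otimes> t \<ominus> b \<otimes> s) = \<zero>"
    using assms S_carrier[of s] S_carrier[of t] by (simp add: minus_eq r_neg)
  then show ?thesis
    using assms by (subst frac_eq_iff) (auto intro: bexI[of _ \<one>])
qed

lemma frac_UN:
  assumes "a \<in> carrier R" "s \<in> S" "b \<in> carrier R" "t \<in> S"
    and "\<And>a' s' b' t'. ((a, s), (a', s')) \<in> loc_rel R S \<Longrightarrow> ((b, t), (b', t')) \<in> loc_rel R S \<Longrightarrow>
           f a' s' b' t' = (f a s b t :: ('a \<times> 'a) set)"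
  shows "(\<Union>(a', s')\<in>loc_frac R S a s. \<Union>(b', t')\<in>loc_frac R S b t. f a' s' b' t') = f a s b t"
proof -
  have "((a, s), (a, s)) \<in> loc_rel R S" "((b, t), (b, t)) \<in> loc_rel R S"
    using equiv_loc_rel assms(1-4) by (auto simp: equiv_def refl_on_def)
  then show ?thesis
    using assms(5) unfolding loc_frac_def by fast
qed

lemma mult_frac:
  assumes "a \<in> carrier R" "s \<in> S" "b \<in> carrier R" "t \<in> S"
  shows "loc_frac R S a s \<otimes>\<^bsub>localization R S\<^esub> loc_frac R S b t = loc_frac R S (a \<otimes> b) (s \<otimes> t)"
proof -
  have "loc_frac R S (a' \<otimes> b') (s' \<otimes> t') = loc_frac R S (a \<otimes> b) (s \<otimes> t)"
    if "((a, s), (a', s')) \<in> loc_rel R S" "((b, t), (b', t')) \<in> loc_rel R S" for a' s' b' t'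
  proof -
    have c': "a' \<in> carrier R" "s' \<in> S" "b' \<in> carrier R" "t' \<in> S"
      and "\<exists>u\<in>S. u \<otimes> (a \<otimes> s' \<ominus> a' \<otimes> s) = \<zero>"
      and "\<exists>v\<in>S. v \<otimes> (b \<otimes> t' \<ominus> b' \<otimes> t) = \<zero>"
      using that by (simp_all add: loc_rel_def)
    then obtain u v where uv: "u \<in> S" "v \<in> S"
      and e: "u \<otimes> (a \<otimes> s' \<ominus> a' \<otimes> s) = \<zero>" "v \<otimes> (b \<otimes> t' \<ominus> b' \<otimes> t) = \<zero>"
      by blast
    note c = c' uv
    have "u \<otimes> v \<otimes> ((a' \<otimes> b') \<otimes> (s \<otimes> t) \<ominus> (a \<otimes> b) \<otimes> (s' \<otimes> t')) =
        \<ominus> (v \<otimes> b' \<otimes> t \<otimes> (u \<otimes> (a \<otimes> s' \<ominus> a' \<otimes> s))) \<ominus> u \<otimes> a \<otimes> s' \<otimes> (v \<otimes> (b \<otimes> t' \<ominus> b' \<otimes> t))"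
      using assms c S_carrier[of s] S_carrier[of t] S_carrier[of u] S_carrier[of v]
        S_carrier[of s'] S_carrier[of t'] by algebra
    also have "\<dots> = \<zero>"
      unfolding e using assms c S_carrier by (simp add: minus_eq)
    finally show ?thesis
      using assms c S_carrier by (subst frac_eq_iff) (auto intro!: bexI[of _ "u \<otimes> v"])
  qed
  from frac_UN[OF assms, of "\<lambda>a s b t. loc_frac R S (a \<otimes> b) (s \<otimes> t)", OF this]
  show ?thesis by (simp add: localization_def)
qed

lemma add_frac:
  assumes "a \<in> carrier R" "s \<in> S" "b \<in> carrier R" "t \<in> S"
  shows "loc_frac R S a s \<oplus>\<^bsub>localization R S\<^esub> loc_frac R S b t =
    loc_frac R S (a \<otimes> t \<oplus> b \<otimes> s) (s \<otimes> t)"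
proof -
  have "loc_frac R S (a' \<otimes> t' \<oplus> b' \<otimes> s') (s' \<otimes> t') = loc_frac R S (a \<otimes> t \<oplus> b \<otimes> s) (s \<otimes> t)"
    if "((a, s), (a', s')) \<in> loc_rel R S" "((b, t), (b', t')) \<in> loc_rel R S" for a' s' b' t'
  proof -
    have c': "a' \<in> carrier R" "s' \<in> S" "b' \<in> carrier R" "t' \<in> S"
      and "\<exists>u\<in>S. u \<otimes> (a \<otimes> s' \<ominus> a' \<otimes> s) = \<zero>"
      and "\<exists>v\<in>S. v \<otimes> (b \<otimes> t' \<ominus> b' \<otimes> t) = \<zero>"
      using that by (simp_all add: loc_rel_def)
    then obtain u v where uv: "u \<in> S" "v \<in> S"
      and e: "u \<otimes> (a \<otimes> s' \<ominus> a' \<otimes> s) = \<zero>" "v \<otimes> (b \<otimes> t' \<ominus> b' \<otimes> t) = \<zero>"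
      by blast
    note c = c' uv
    have "u \<otimes> v \<otimes> ((a' \<otimes> t' \<oplus> b' \<otimes> s') \<otimes> (s \<otimes> t) \<ominus> (a \<otimes> t \<oplus> b \<otimes> s) \<otimes> (s' \<otimes> t')) =
        \<ominus> (v \<otimes> t \<otimes> t' \<otimes> (u \<otimes> (a \<otimes> s' \<ominus> a' \<otimes> s))) \<ominus> u \<otimes> s \<otimes> s' \<otimes> (v \<otimes> (b \<otimes> t' \<ominus> b' \<otimes> t))"
      using assms c S_carrier[of s] S_carrier[of t] S_carrier[of u] S_carrier[of v]
        S_carrier[of s'] S_carrier[of t'] by algebra
    also have "\<dots> = \<zero>"
      unfolding e using assms c S_carrier by (simp add: minus_eq)
    finally show ?thesis
      using assms c S_carrier by (subst frac_eq_iff) (auto intro!: bexI[of _ "u \<otimes> v"])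
  qed
  from frac_UN[OF assms, of "\<lambda>a s b t. loc_frac R S (a \<otimes> t \<oplus> b \<otimes> s) (s \<otimes> t)", OF this]
  show ?thesis by (simp add: localization_def)
qed

lemma one_frac: "\<one>\<^bsub>localization R S\<^esub> = loc_frac R S \<one> \<one>"
  by (simp add: localization_def)

lemma zero_frac: "\<zero>\<^bsub>localization R S\<^esub> = loc_frac R S \<zero> \<one>"
  by (simp add: localization_def)

lemma cring_localization: "cring (localization R S)"
proof (rule cringI)
  let ?L = "localization R S"
  note fr = add_frac mult_frac one_frac zero_frac
  show "abelian_group ?L"
  proof (rule abelian_groupI)
    fix U V W assume "U \<in> carrier ?L" "V \<in> carrier ?L" "W \<in> carrier ?L"
    then obtain a s b t c w where c: "a \<in> carrier R" "s \<in> S" "b \<in> carrier R" "t \<in> S"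
        "c \<in> carrier R" "w \<in> S"
      and U: "U = loc_frac R S a s" "V = loc_frac R S b t" "W = loc_frac R S c w"
      by (metis carrier_cases)
    note cc = c S_carrier[OF c(2)] S_carrier[OF c(4)] S_carrier[OF c(6)]
    have "((a \<otimes> t \<oplus> b \<otimes> s) \<otimes> w \<oplus> c \<otimes> (s \<otimes> t)) \<otimes> (s \<otimes> (t \<otimes> w)) =
        (a \<otimes> (t \<otimes> w) \<oplus> (b \<otimes> w \<oplus> c \<otimes> t) \<otimes> s) \<otimes> (s \<otimes> t \<otimes> w)"
      using cc by algebra
    then show "(U \<oplus>\<^bsub>?L\<^esub> V) \<oplus>\<^bsub>?L\<^esub> W = U \<oplus>\<^bsub>?L\<^esub> (V \<oplus>\<^bsub>?L\<^esub> W)"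
      using cc by (simp add: U fr, intro frac_eqI) simp_all
  next
    fix U V assume "U \<in> carrier ?L" "V \<in> carrier ?L"
    then obtain a s b t where c: "a \<in> carrier R" "s \<in> S" "b \<in> carrier R" "t \<in> S"
      and U: "U = loc_frac R S a s" "V = loc_frac R S b t"
      by (metis carrier_cases)
    note cc = c S_carrier[OF c(2)] S_carrier[OF c(4)]
    show "U \<oplus>\<^bsub>?L\<^esub> V \<in> carrier ?L"
      using cc by (simp add: U fr frac_in_carrier)
    show "U \<oplus>\<^bsub>?L\<^esub> V = V \<oplus>\<^bsub>?L\<^esub> U"
      using cc by (simp add: U fr m_comm a_comm)
  next
    show "\<zero>\<^bsub>?L\<^esub> \<in> carrier ?L" by (simp add: fr frac_in_carrier)
  next
    fix U assume "U \<in> carrier ?L"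
    then obtain a s where c: "a \<in> carrier R" "s \<in> S" and U: "U = loc_frac R S a s"
      by (metis carrier_cases)
    note cc = c S_carrier[OF c(2)]
    show "\<zero>\<^bsub>?L\<^esub> \<oplus>\<^bsub>?L\<^esub> U = U"
      using cc by (simp add: U fr)
    have "loc_frac R S (\<ominus> a) s \<oplus>\<^bsub>?L\<^esub> U = \<zero>\<^bsub>?L\<^esub>"
      using cc by (simp add: U fr, intro frac_eqI) (simp_all add: l_minus l_neg)
    then show "\<exists>V\<in>carrier ?L. V \<oplus>\<^bsub>?L\<^esub> U = \<zero>\<^bsub>?L\<^esub>"
      using cc frac_in_carrier by blast
  qed
  show "comm_monoid ?L"
  proof (rule comm_monoidI)
    fix U V W assume "U \<in> carrier ?L" "V \<in> carrier ?L" "W \<in> carrier ?L"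
    then obtain a s b t c w where c: "a \<in> carrier R" "s \<in> S" "b \<in> carrier R" "t \<in> S"
        "c \<in> carrier R" "w \<in> S"
      and U: "U = loc_frac R S a s" "V = loc_frac R S b t" "W = loc_frac R S c w"
      by (metis carrier_cases)
    note cc = c S_carrier[OF c(2)] S_carrier[OF c(4)] S_carrier[OF c(6)]
    show "(U \<otimes>\<^bsub>?L\<^esub> V) \<otimes>\<^bsub>?L\<^esub> W = U \<otimes>\<^bsub>?L\<^esub> (V \<otimes>\<^bsub>?L\<^esub> W)"
      using cc by (simp add: U fr m_assoc)
  next
    fix U V assume "U \<in> carrier ?L" "V \<in> carrier ?L"
    then obtain a s b t where c: "a \<in> carrier R" "s \<in> S" "b \<in> carrier R" "t \<in> S"
      and U: "U = loc_frac R S a s" "V = loc_frac R S b t"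
      by (metis carrier_cases)
    note cc = c S_carrier[OF c(2)] S_carrier[OF c(4)]
    show "U \<otimes>\<^bsub>?L\<^esub> V \<in> carrier ?L"
      using cc by (simp add: U fr frac_in_carrier)
    show "U \<otimes>\<^bsub>?L\<^esub> V = V \<otimes>\<^bsub>?L\<^esub> U"
      using cc by (simp add: U fr m_comm)
  next
    show "\<one>\<^bsub>?L\<^esub> \<in> carrier ?L" by (simp add: fr frac_in_carrier)
  next
    fix U assume "U \<in> carrier ?L"
    then obtain a s where c: "a \<in> carrier R" "s \<in> S" and U: "U = loc_frac R S a s"
      by (metis carrier_cases)
    show "\<one>\<^bsub>?L\<^esub> \<otimes>\<^bsub>?L\<^esub> U = U"
      using c S_carrier[OF c(2)] by (simp add: U fr)
  qed
  fix U V W assume "U \<in> carrier ?L" "V \<in> carrier ?L" "W \<in> carrier ?L"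
  then obtain a s b t c w where c: "a \<in> carrier R" "s \<in> S" "b \<in> carrier R" "t \<in> S"
      "c \<in> carrier R" "w \<in> S"
    and U: "U = loc_frac R S a s" "V = loc_frac R S b t" "W = loc_frac R S c w"
    by (metis carrier_cases)
  note cc = c S_carrier[OF c(2)] S_carrier[OF c(4)] S_carrier[OF c(6)]
  have "(a \<otimes> t \<oplus> b \<otimes> s) \<otimes> c \<otimes> (s \<otimes> w \<otimes> (t \<otimes> w)) =
      (a \<otimes> c \<otimes> (t \<otimes> w) \<oplus> b \<otimes> c \<otimes> (s \<otimes> w)) \<otimes> (s \<otimes> t \<otimes> w)"
    using cc by algebra
  then show "(U \<oplus>\<^bsub>?L\<^esub> V) \<otimes>\<^bsub>?L\<^esub> W = U \<otimes>\<^bsub>?L\<^esub> W \<oplus>\<^bsub>?L\<^esub> V \<otimes>\<^bsub>?L\<^esub> W"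
    using cc by (simp add: U fr, intro frac_eqI) simp_all
qed

lemma loc_map_ring_hom: "loc_map R S \<in> ring_hom R (localization R S)"
  by (rule ring_hom_memI)
    (simp_all add: loc_map_def frac_in_carrier mult_frac add_frac one_frac)

end

end

theory Submission
  imports Defs
begin

text \<open>All four conditions ask for one and the same element \<open>s\<close>: being an \<open>S\<close>-\<open>r\<close>-ideal with
  witness \<open>s\<close> means that \<open>s\<close> multiplies every colon ideal \<open>(A : r)\<close> with \<open>r\<close> regular into \<open>A\<close>, and
  this passes to each of the other conditions with \<open>s\<close> unchanged. An element of \<open>rH \<inter> A\<close> is a
  product \<open>rz\<close> with \<open>z \<in> (A : r)\<close>, and since \<open>r\<close> can be cancelled, \<open>s (rz) \<in> rA\<close> says exactly
  \<open>sz \<in> A\<close> (lemma \<open>lcos_genideal_subset_iff_colon\<close>). The contraction to \<open>H\<close> of the extension of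
  \<open>A\<close> to the localization is the union of the colon ideals \<open>(A : r)\<close> over the denominators \<open>r\<close>
  (lemma \<open>vimage_loc_ideal_eq_UN_colon\<close>), and multiplying a union into \<open>A\<close> means multiplying each
  of its members into \<open>A\<close>. The definition of an \<open>S\<close>-\<open>r\<close>-ideal also demands that \<open>S\<close> be
  multiplicatively closed, which regular elements are.\<close>

context cring
begin

lemma reg_mult_eq_zero:
  assumes "r \<in> reg R" "z \<in> carrier R" "r \<otimes> z = \<zero>"
  shows "z = \<zero>"
proof -
  have "z \<otimes> r = \<zero>"
    using assms by (simp add: reg_def m_comm)
  then have "z \<in> Ann R r"
    using assms by (simp add: Ann_def)
  then show ?thesis
    using assms by (simp add: reg_def)
qed

lemma reg_cancel:
  assumes r: "r \<in> reg R" and x: "x \<in> carrier R" and y: "y \<in> carrier R"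
    and eq: "r \<otimes> x = r \<otimes> y"
  shows "x = y"
proof -
  have c: "r \<in> carrier R"
    using r by (simp add: reg_def)
  have "r \<otimes> (x \<ominus> y) = r \<otimes> x \<ominus> r \<otimes> y"
    using c x y by algebra
  also have "\<dots> = \<zero>"
    using c y by (simp add: eq minus_eq r_neg)
  finally have "x \<ominus> y = \<zero>"
    using reg_mult_eq_zero[OF r] x y by simp
  then show ?thesis
    using x y minus_equality[of x "\<ominus> y"] by (simp add: minus_eq)
qed

lemma submonoid_reg: "submonoid (reg R) R"
proof
  show "reg R \<subseteq> carrier R"
    by (auto simp: reg_def)
  show "\<one> \<in> reg R"
    by (auto simp: reg_def Ann_def)
next
  fix x y assume x: "x \<in> reg R" and y: "y \<in> reg R"
  then have c: "x \<in> carrier R" "y \<in> carrier R"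
    by (auto simp: reg_def)
  have "z = \<zero>" if z: "z \<in> carrier R" and "z \<otimes> (x \<otimes> y) = \<zero>" for z
  proof -
    have "x \<otimes> (y \<otimes> z) = \<zero>"
      using that c by (simp add: m_ac)
    then have "y \<otimes> z = \<zero>"
      using reg_mult_eq_zero[OF x] c z by simp
    then show ?thesis
      using reg_mult_eq_zero[OF y z] by simp
  qed
  then show "x \<otimes> y \<in> reg R"
    using c by (auto simp: reg_def Ann_def)
qed

text \<open>Multiplication by the regular element \<open>r\<close> is a bijection of \<open>(A : r)\<close> onto \<open>rH \<inter> A\<close> and
  of \<open>A\<close> onto \<open>rA\<close>, and it commutes with multiplication by \<open>s\<close>; so the inclusion on the left is
  the one on the right multiplied by \<open>r\<close>.\<close>

lemma lcos_genideal_subset_iff_colon: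
  assumes A: "A \<subseteq> carrier R" and r: "r \<in> reg R" and s: "s \<in> carrier R"
  shows "s <# (PIdl r \<inter> A) \<subseteq> r <# A \<longleftrightarrow> s <# colon R A r \<subseteq> A"
proof
  have rc: "r \<in> carrier R"
    using r by (simp add: reg_def)
  show "s <# colon R A r \<subseteq> A" if incl: "s <# (PIdl r \<inter> A) \<subseteq> r <# A"
  proof
    fix y assume "y \<in> s <# colon R A r"
    then obtain z where z: "z \<in> carrier R" "z \<otimes> r \<in> A" and y: "y = s \<otimes> z"
      by (auto simp: l_coset_def colon_def)
    have "s \<otimes> (z \<otimes> r) \<in> s <# (PIdl r \<inter> A)"
      using z by (auto simp: l_coset_def cgenideal_def)
    then obtain a where a: "a \<in> A" "s \<otimes> (z \<otimes> r) = r \<otimes> a"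
      using incl by (auto simp: l_coset_def)
    have "r \<otimes> (s \<otimes> z) = r \<otimes> a"
      using a(2) z rc s by (simp add: m_ac)
    then have "s \<otimes> z = a"
      using reg_cancel[OF r] s z a(1) A by (simp add: subsetD)
    then show "y \<in> A"
      using a(1) y by simp
  qed
  show "s <# (PIdl r \<inter> A) \<subseteq> r <# A" if incl: "s <# colon R A r \<subseteq> A"
  proof
    fix y assume "y \<in> s <# (PIdl r \<inter> A)"
    then obtain z where z: "z \<in> carrier R" "z \<otimes> r \<in> A" and y: "y = s \<otimes> (z \<otimes> r)"
      by (auto simp: l_coset_def cgenideal_def)
    have "s \<otimes> z \<in> A"
      using incl z by (auto simp: l_coset_def colon_def)
    moreover have "y = r \<otimes> (s \<otimes> z)"
      using y z rc s by (simp add: m_ac)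
    ultimately show "y \<in> r <# A"
      by (auto simp: l_coset_def)
  qed
qed

lemma S_r_ideal_reg_iff_colon:
  assumes A: "ideal A R" and disj: "reg R \<inter> A = {}"
  shows "S_r_ideal R (reg R) A \<longleftrightarrow> (\<exists>s\<in>reg R. \<forall>r\<in>reg R. s <# colon R A r \<subseteq> A)"
proof -
  have "(\<forall>w\<in>carrier R. \<forall>z\<in>carrier R. w \<otimes> z \<in> A \<longrightarrow> Ann R w = {\<zero>} \<longrightarrow> s \<otimes> z \<in> A) \<longleftrightarrow>
      (\<forall>r\<in>reg R. s <# colon R A r \<subseteq> A)" for s
  proof -
    have "s <# colon R A w \<subseteq> A \<longleftrightarrow> (\<forall>z\<in>carrier R. w \<otimes> z \<in> A \<longrightarrow> s \<otimes> z \<in> A)"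
      if w: "w \<in> carrier R" for w
    proof -
      have "colon R A w = {z \<in> carrier R. w \<otimes> z \<in> A}"
        unfolding colon_def by (rule Collect_cong) (use w m_comm in metis)
      then show ?thesis
        by (auto simp: l_coset_def)
    qed
    then show ?thesis
      by (auto simp: reg_def)
  qed
  then show ?thesis
    using A disj submonoid_reg by (simp add: S_r_ideal_def Int_commute)
qed

end

text \<open>This holds for any multiplicatively closed set of denominators. If \<open>xr \<in> A\<close>, then
  \<open>x / 1 = (xr) / r\<close>. Conversely, \<open>x / 1 = a / t\<close> gives some \<open>u \<in> S\<close> with \<open>u (xt - a) = 0\<close>, so that
  \<open>x (ut) = ua \<in> A\<close>.\<close>

lemma (in ring_with_mult_subset) vimage_loc_ideal_eq_UN_colon:
  assumes A: "ideal A R"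
  shows "loc_map R S -` loc_ideal R S A \<inter> carrier R = (\<Union>r\<in>S. colon R A r)"
proof (intro equalityI subsetI)
  interpret A: ideal A R by fact
  fix x assume "x \<in> loc_map R S -` loc_ideal R S A \<inter> carrier R"
  then obtain a t where x: "x \<in> carrier R" and a: "a \<in> A" and t: "t \<in> S"
    and "loc_frac R S x \<one> = loc_frac R S a t"
    by (auto simp: loc_map_def loc_ideal_def)
  moreover have ac: "a \<in> carrier R"
    using a by (rule A.Icarr)
  ultimately obtain u where u: "u \<in> S" and e: "u \<otimes> (x \<otimes> t \<ominus> a \<otimes> \<one>) = \<zero>"
    using frac_eq_iff[of x \<one> a t] by auto
  note c = x ac S_carrier[OF t] S_carrier[OF u]
  have "x \<otimes> (u \<otimes> t) = u \<otimes> (x \<otimes> t \<ominus> a \<otimes> \<one>) \<oplus> u \<otimes> a"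
    using c by algebra
  also have "\<dots> = u \<otimes> a"
    using c by (simp only: e) simp
  finally have "x \<otimes> (u \<otimes> t) \<in> A"
    using a c by (simp add: A.I_l_closed)
  then show "x \<in> (\<Union>r\<in>S. colon R A r)"
    using x u t by (auto simp: colon_def intro!: bexI[of _ "u \<otimes> t"])
next
  fix x assume "x \<in> (\<Union>r\<in>S. colon R A r)"
  then obtain r where x: "x \<in> carrier R" and r: "r \<in> S" and xr: "x \<otimes> r \<in> A"
    by (auto simp: colon_def)
  have "loc_frac R S x \<one> = loc_frac R S (x \<otimes> r) r"
    using x r S_carrier[OF r] by (intro frac_eqI) simp_all
  then show "x \<in> loc_map R S -` loc_ideal R S A \<inter> carrier R"
    using x r xr by (auto simp: loc_map_def loc_ideal_def)
qed

theorem theorem2p1: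
  fixes H :: "('a, 'm) ring_scheme" (structure) and S A :: "'a set"
  assumes "cring H"
    and "S = reg H"
    and "ideal A H" and "A \<noteq> carrier H"
    and "S \<inter> A = {}"
  shows
    "(S_r_ideal H S A \<longleftrightarrow>
        (\<exists>s\<in>S. \<forall>r\<in>reg H. s <# (PIdl r \<inter> A) \<subseteq> r <# A)) \<and>
     (S_r_ideal H S A \<longleftrightarrow>
        (\<exists>s\<in>S. \<forall>r\<in>reg H. s <# colon H A r \<subseteq> A)) \<and>
     (S_r_ideal H S A \<longleftrightarrow>
        (\<exists>s\<in>S. s <# (loc_map H S -` loc_ideal H S A \<inter> carrier H) \<subseteq> A))"
proof -
  interpret cring H by fact
  interpret A: ideal A H by fact
  interpret ring_with_mult_subset S H
    using \<open>cring H\<close> submonoid_reg \<open>S = reg H\<close> by (simp add: ring_with_mult_subset_def)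
  have c: "S_r_ideal H S A \<longleftrightarrow> (\<exists>s\<in>S. \<forall>r\<in>reg H. s <# colon H A r \<subseteq> A)"
    using S_r_ideal_reg_iff_colon[of A] assms by simp
  have b: "(\<forall>r\<in>reg H. s <# (PIdl r \<inter> A) \<subseteq> r <# A) \<longleftrightarrow> (\<forall>r\<in>reg H. s <# colon H A r \<subseteq> A)"
    if "s \<in> S" for s
    using lcos_genideal_subset_iff_colon[OF A.a_subset] S_carrier[OF that] by simp
  have d: "s <# (loc_map H S -` loc_ideal H S A \<inter> carrier H) \<subseteq> A \<longleftrightarrow>
      (\<forall>r\<in>reg H. s <# colon H A r \<subseteq> A)" for s
    unfolding vimage_loc_ideal_eq_UN_colon[OF \<open>ideal A H\<close>] unfolding \<open>S = reg H\<close>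
    by (auto simp: l_coset_def)
  show ?thesis
    using b c d by simp
qed

end
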